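(* Let $C^{ijkl}$ be an elasticity tensor in three dimensions, and let $A^{ijkl}:=C^{ijkl}-C^{(ijkl)}$ and $N^{ijkl}:=C^{i[jk]l}$. Then $$N^{ijkl}=A^{i[jk]l},$$ and conversely $$A^{ijkl}=\tfrac43\,N^{ij(kl)} .$$
   Context: Indices run over $1,2,3$. An elasticity tensor is a real fourth-rank tensor $C^{ijkl}$ on $\mathbb R^3$ with $C^{ijkl}=C^{jikl}$, $C^{ijkl}=C^{ijlk}$ (minor symmetries) and $C^{ijkl}=C^{klij}$ (major symmetry). Parentheses around $p$ indices denote total symmetrization ($\frac1{p!}$ times the sum over all permutations); brackets around two indices denote antisymmetrization: $T^{i[jk]l}=\frac12(T^{ijkl}-T^{ikjl})$. *)

theory Defs
  imports "HOL-Analysis.Analysis" "HOL-Combinatorics.Permutations"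
begin

type_synonym tensor4 = "real ^ 3 ^ 3 ^ 3 ^ 3"

definition elasticity_tensor :: "tensor4 \<Rightarrow> bool" where
  "elasticity_tensor C \<longleftrightarrow> (\<forall>i j k l.
     C $ i $ j $ k $ l = C $ j $ i $ k $ l \<and>
     C $ i $ j $ k $ l = C $ i $ j $ l $ k \<and>
     C $ i $ j $ k $ l = C $ k $ l $ i $ j)"

text \<open>Symmetrization over the index slots in \<open>S\<close>, where the four slots are numbered 0, 1, 2, 3 from
  left to right: slots \<open>{..<4}\<close> give \<open>T\<^sup>(\<^sup>i\<^sup>j\<^sup>k\<^sup>l\<^sup>)\<close>, slots \<open>{2, 3}\<close> give \<open>T\<^sup>i\<^sup>j\<^sup>(\<^sup>k\<^sup>l\<^sup>)\<close>.\<close>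

definition symmetrize :: "nat set \<Rightarrow> tensor4 \<Rightarrow> tensor4" where
  "symmetrize S T = (\<chi> i j k l.
     (\<Sum>p | p permutes S.
        T $ ([i, j, k, l] ! p 0) $ ([i, j, k, l] ! p 1) $ ([i, j, k, l] ! p 2) $ ([i, j, k, l] ! p 3))
     / fact (card S))"

definition antisym_middle :: "tensor4 \<Rightarrow> tensor4" where
  "antisym_middle T = (\<chi> i j k l. (T $ i $ j $ k $ l - T $ i $ k $ j $ l) / 2)"

end

theory Submission imports Defs begin

text \<open>The total symmetrization of \<open>C\<close> is symmetric in its middle indices, so it
  drops out of \<open>antisym_middle A\<close>. For the converse,
  \<open>symmetrize_elasticity_tensor\<close> turns \<open>A\<close> into (2 C^{ijkl} - C^{ikjl} -
  C^{iljk}) / 3, while N^{ij(kl)} is the same numerator over 4; hence the factor 4/3.\<close>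

lemma symmetrize_last_two:
  "symmetrize {2, 3} T $ i $ j $ k $ l = (T $ i $ j $ k $ l + T $ i $ j $ l $ k) / 2"
  unfolding symmetrize_def
  by (simp add: sum_over_permutations_insert permutes_sing transpose_def)

text \<open>The minor and major symmetries generate a group of order 8, so the 24 permuted entries
  fall into three classes of 8, one for each splitting of the four slots into two pairs.\<close>

lemma symmetrize_elasticity_tensor:
  assumes "elasticity_tensor C"
  shows "symmetrize {..<4} C $ i $ j $ k $ l =
    (C $ i $ j $ k $ l + C $ i $ k $ j $ l + C $ i $ l $ j $ k) / 3"
proof -
  have slots: "{..<4} = {0, 1, 2, 3::nat}"
    by auto
  have swap_first: "C $ a $ b $ c $ d = C $ b $ a $ c $ d"
    and swap_last: "C $ a $ b $ c $ d = C $ a $ b $ d $ c"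
    and swap_pairs: "C $ a $ b $ c $ d = C $ c $ d $ a $ b" for a b c d
    using assms unfolding elasticity_tensor_def by blast+
  have orbit: "C $ b $ a $ c $ d = C $ a $ b $ c $ d" "C $ a $ b $ d $ c = C $ a $ b $ c $ d"
    "C $ b $ a $ d $ c = C $ a $ b $ c $ d" "C $ c $ d $ a $ b = C $ a $ b $ c $ d"
    "C $ c $ d $ b $ a = C $ a $ b $ c $ d" "C $ d $ c $ a $ b = C $ a $ b $ c $ d"
    "C $ d $ c $ b $ a = C $ a $ b $ c $ d" for a b c d
    by (metis swap_first swap_last swap_pairs)+
  show ?thesis
    unfolding symmetrize_def slots
    by (simp add: sum_over_permutations_insert permutes_sing transpose_def fact_numeral)
      (use orbit[of i j k l] orbit[of i k j l] orbit[of i l j k] in linarith)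
qed

theorem proposition9:
  fixes C A N :: tensor4
  assumes "elasticity_tensor C"
    and "A = C - symmetrize {..<4} C"
    and "N = antisym_middle C"
  shows "N = antisym_middle A \<and> A = (4 / 3) *\<^sub>R symmetrize {2, 3} N"
proof
  have A: "A $ i $ j $ k $ l =
      C $ i $ j $ k $ l - (C $ i $ j $ k $ l + C $ i $ k $ j $ l + C $ i $ l $ j $ k) / 3" for i j k l
    by (simp add: assms(2) symmetrize_elasticity_tensor[OF assms(1)])
  have N: "N $ i $ j $ k $ l = (C $ i $ j $ k $ l - C $ i $ k $ j $ l) / 2" for i j k l
    by (simp add: assms(3) antisym_middle_def)
  have swap_last: "C $ i $ j $ k $ l = C $ i $ j $ l $ k" for i j k l
    using assms(1) unfolding elasticity_tensor_def by blast
  show "N = antisym_middle A"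
    \<comment> \<open>The symmetric parts cancel up to C^{iljk} against C^{ilkj}, which a minor
      symmetry identifies.\<close>
    by (simp add: vec_eq_iff antisym_middle_def A N field_simps)
      (metis swap_last)
  show "A = (4 / 3) *\<^sub>R symmetrize {2, 3} N"
    \<comment> \<open>Here C^{ijlk} must merge with C^{ijkl} to give the coefficient 2.\<close>
    by (simp add: vec_eq_iff symmetrize_last_two A N field_simps)
      (metis swap_last)
qed

end
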